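(* Let $\tau$ be a finite relational vocabulary, $\mathcal{Q}$ a finite set of generalized quantifiers of width $1$ and type $(1)$, and $d\in\mathbb{N}$. Assume (induction hypothesis for $d$) that for all $\tau$-models $\mathfrak{A}',\mathfrak{B}'$ and all assignments $f',g'$ over $\mathfrak{A}'$ and $\mathfrak{B}'$ with $\mathrm{dom}(f')=\mathrm{dom}(g')$, Player $\mathbb{I}$ has a winning strategy in the $\mathrm{EF}_d\{\mathcal{Q}\}(\mathfrak{A}',\mathfrak{B}',f',g')$-game if and only if $(\mathfrak{A}',f')$ and $(\mathfrak{B}',g')$ are separable in $\mathrm{FO}(\mathcal{Q})^d$. Let $\mathfrak{A},\mathfrak{B}$ be $\tau$-models and $f,g$ assignments over them with $\mathrm{dom}(f)=\mathrm{dom}(g)$. If Player $\mathbb{I}$ has a winning strategy in the $\mathrm{EF}_{d+1}\{\mathcal{Q}\}(\mathfrak{A},\mathfrak{B},f,g)$-game, then $(\mathfrak{A},f)$ and $(\mathfrak{B},g)$ are separable in $\mathrm{FO}(\mathcal{Q})^{d+1}$.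
   Context: **Logic.** $\tau$ is a finite set of relation symbols with arities in $\mathbb{N}$. A $\tau$-model $\mathfrak{A}$ has a non-empty, possibly infinite domain $A$ and a relation $R^{\mathfrak{A}}\subseteq A^k$ for each $k$-ary $R\in\tau$. $\mathrm{VAR}$ is a countably infinite set of variables. An assignment over $\mathfrak{A}$ is a (possibly empty) function $f:X\to A$ with $X\subseteq\mathrm{VAR}$ finite; $f\frac{a}{x}$ is the assignment with domain $\mathrm{dom}(f)\cup\{x\}$ that maps $x$ to $a$ and agrees with $f$ elsewhere, and $\frac{a}{x}$ alone denotes the assignment $\{(x,a)\}$. A generalized quantifier of width $1$ and type $(1)$ is an isomorphism-closed class $Q$ of structures $(D,P)$ with $P\subseteq D$. For a finite set $\mathcal{Q}$ of these (which need not contain $\exists$ or $\forall$), $\mathrm{FO}(\mathcal{Q})$ is built from the atomic formulas $x=y$ and $R(x_1,\dots,x_k)$ using Boolean connectives and $Qx\,\varphi$ for $Q\in\mathcal{Q}$, $x\in\mathrm{VAR}$. Semantics: atoms and connectives as usual, and $\mathfrak{A},f\models Qx\,\varphi$ iff $(A,\|\varphi\|^{\mathfrak{A},f}_x)\in Q$, where $\|\varphi\|^{\mathfrak{A},f}_x=\{a\in A\mid \mathfrak{A},f\frac{a}{x}\models\varphi\}$; here $\mathrm{dom}(f)$ contains all free variables of the formula being evaluated. The quantifier depth of a formula is its maximum number of nested quantifiers from $\mathcal{Q}$ (Boolean connectives do not count); $\mathrm{FO}(\mathcal{Q})^d$ is the set of formulas of depth at most $d$. $(\mathfrak{A},f)$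 and $(\mathfrak{B},g)$ are separable in $\mathrm{FO}(\mathcal{Q})^d$ if some $\varphi\in\mathrm{FO}(\mathcal{Q})^d$ satisfies $\mathfrak{A},f\models\varphi$ and $\mathfrak{B},g\not\models\varphi$. **Partial isomorphism.** A pair $(f,g)$ of assignments with $\mathrm{dom}(f)=\mathrm{dom}(g)$ induces a partial isomorphism between $\mathfrak{A}$ and $\mathfrak{B}$ if $\mathfrak{A},f\models\alpha\iff\mathfrak{B},g\models\alpha$ for every atomic $\alpha$ with free variables in $\mathrm{dom}(f)$. **The game.** $\mathrm{EF}\{\mathcal{Q}\}(\mathfrak{A},\mathfrak{B},f,g)$ is a two-player game starting from position $(\mathfrak{A},\mathfrak{B},f,g)$ with Player $\mathbb{I}$ as attacker and Player $\mathbb{II}$ as defender. A round from position $(\mathfrak{M},\mathfrak{N},h,h')$ goes as follows. 1. The attacker chooses $Q\in\mathcal{Q}$ and $x\in\mathrm{VAR}$. 2. The attacker chooses a witness set $X$ from the domain of either model (without loss of generality $X\subseteq M$; equivalently, the attacker may first switch which model is called $\mathfrak{M}$ and which $\mathfrak{N}$) with $(M,X)\in Q$, and a spillover set $P\subseteq N$ from the domain of the other model. 3. The defender chooses a witness set $X'\subseteq N$ with $(N,X')\in Q$ and $P\subseteq X'$. 4. The attacker does one of the following. (a) Chooses $v'\in N\setminus X'$ and $v\in X$; the players swap roles; the next position is $(\mathfrak{M},\mathfrak{N},h\frac{v}{x},h'\frac{v'}{x})$. (b) Chooses $v'\in X'$; the defender then either chooses $v\in X$, after which the next position is $(\mathfrak{M},\mathfrak{N},h\frac{v}{x},h'\frac{v'}{x})$,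 or chooses $v\in P$, after which the next position is $(\mathfrak{N},\mathfrak{N},\frac{v}{x},\frac{v'}{x})$. 5. If the pair of assignments of the position just determined does not induce a partial isomorphism between its two models, the game ends and the attacker wins; otherwise a new round begins from this position. Contesting: at any point during steps 2–3, immediately after a set is chosen, the opposing player may contest that choice; the remaining steps of the round are then skipped and replaced as follows. *Contesting a witness set:* after $X$ is chosen in step 2 or $X'$ in step 3, the opposing player chooses $u\in Y$ and $u'\in W\setminus Y$, where $Y$ is the contested set and $W$ its domain; if the contesting player is the attacker, the players swap roles; the next position is $(\mathfrak{W},\mathfrak{W},h_W\frac{u}{x},h_W\frac{u'}{x})$, where $h_W=h$ if $W=M$ and $h_W=h'$ if $W=N$. *Contesting a spillover set:* after $P$ is chosen in step 2, the opposing player chooses $v'\in P$ and $v\in M$; the next position is $(\mathfrak{M},\mathfrak{N},h\frac{v}{x},h'\frac{v'}{x})$. In both cases the game proceeds to step 5 with the new position. If at any point a player must make a move but cannot do so, the other player wins immediately. **Bounded game.** The winner of the $\mathrm{EF}_d\{\mathcal{Q}\}(\mathfrak{A},\mathfrak{B},f,g)$-game, in which the number of rounds played is restricted to $d$, is defined as follows. $\mathrm{EF}_0\{\mathcal{Q}\}(\mathfrak{A},\mathfrak{B},f,g)$ is won by Player $\mathbb{I}$ if $(f,g)$ does not induce a partial isomorphism between $\mathfrak{A}$ and $\mathfrak{B}$, and otherwise by Player $\mathbb{II}$. $\mathrm{EF}_{d+1}\{\mathcal{Q}\}(\mathfrak{A},\mathfrak{B},f,g)$ is won by Player $\mathbb{II}$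 if Player $\mathbb{I}$ has not won the game after $d+1$ rounds have been played. *)

theory Defs
  imports Main
begin

section \<open>Models and assignments\<close>

text \<open>
  All domains are non-empty subsets of one arbitrary type \<open>'a\<close>, so that models with different
  domains can be compared and occur in the same game. A vocabulary maps its relation symbols to
  their arities. It is a partial map on \<open>'r\<close>, so that it may be empty.
\<close>

type_synonym var = nat
type_synonym 'r vocabulary = "'r \<rightharpoonup> nat"
type_synonym 'a assignment = "var \<rightharpoonup> 'a"

record ('a, 'r) model =
  carrier :: "'a set"
  interp :: "'r \<Rightarrow> 'a list set"

definition is_model :: "'r vocabulary \<Rightarrow> ('a, 'r) model \<Rightarrow> bool" where
  "is_model \<tau> A \<longleftrightarrow> carrier A \<noteq> {} \<and>
     (\<forall>R k. \<tau> R = Some k \<longrightarrow> interp A R \<subseteq> {as. length as = k \<and> set as \<subseteq> carrier A})"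

definition is_assignment :: "('a, 'r) model \<Rightarrow> 'a assignment \<Rightarrow> bool" where
  "is_assignment A f \<longleftrightarrow> finite (dom f) \<and> ran f \<subseteq> carrier A"


section \<open>Generalized quantifiers and the logic\<close>

text \<open>
  A class of structures \<open>(D, P)\<close> is represented by its members with \<open>D\<close> a subset of \<open>'a\<close>. Every
  isomorphism-closed family on \<open>'a\<close> is such a restriction.
\<close>

type_synonym 'a quantifier = "('a set \<times> 'a set) set"

definition is_quantifier :: "'a quantifier \<Rightarrow> bool" where
  "is_quantifier Q \<longleftrightarrow>
     (\<forall>D P. (D, P) \<in> Q \<longrightarrow> P \<subseteq> D) \<and>
     (\<forall>D P D' \<pi>. (D, P) \<in> Q \<and> bij_betw \<pi> D D' \<longrightarrow> (D', \<pi> ` P) \<in> Q)"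

datatype ('a, 'r) formula =
    Eq var var
  | Rel 'r "var list"
  | Neg "('a, 'r) formula"
  | Conj "('a, 'r) formula" "('a, 'r) formula"
  | Disj "('a, 'r) formula" "('a, 'r) formula"
  | Quant "'a quantifier" var "('a, 'r) formula"

primrec formula_over :: "'r vocabulary \<Rightarrow> 'a quantifier set \<Rightarrow> ('a, 'r) formula \<Rightarrow> bool" where
  "formula_over \<tau> \<Q> (Eq x y) \<longleftrightarrow> True"
| "formula_over \<tau> \<Q> (Rel R xs) \<longleftrightarrow> \<tau> R = Some (length xs)"
| "formula_over \<tau> \<Q> (Neg \<phi>) \<longleftrightarrow> formula_over \<tau> \<Q> \<phi>"
| "formula_over \<tau> \<Q> (Conj \<phi> \<psi>) \<longleftrightarrow> formula_over \<tau> \<Q> \<phi> \<and> formula_over \<tau> \<Q> \<psi>"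
| "formula_over \<tau> \<Q> (Disj \<phi> \<psi>) \<longleftrightarrow> formula_over \<tau> \<Q> \<phi> \<and> formula_over \<tau> \<Q> \<psi>"
| "formula_over \<tau> \<Q> (Quant Q x \<phi>) \<longleftrightarrow> Q \<in> \<Q> \<and> formula_over \<tau> \<Q> \<phi>"

primrec free_vars :: "('a, 'r) formula \<Rightarrow> var set" where
  "free_vars (Eq x y) = {x, y}"
| "free_vars (Rel R xs) = set xs"
| "free_vars (Neg \<phi>) = free_vars \<phi>"
| "free_vars (Conj \<phi> \<psi>) = free_vars \<phi> \<union> free_vars \<psi>"
| "free_vars (Disj \<phi> \<psi>) = free_vars \<phi> \<union> free_vars \<psi>"
| "free_vars (Quant Q x \<phi>) = free_vars \<phi> - {x}"

primrec depth :: "('a, 'r) formula \<Rightarrow> nat" where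
  "depth (Eq x y) = 0"
| "depth (Rel R xs) = 0"
| "depth (Neg \<phi>) = depth \<phi>"
| "depth (Conj \<phi> \<psi>) = max (depth \<phi>) (depth \<psi>)"
| "depth (Disj \<phi> \<psi>) = max (depth \<phi>) (depth \<psi>)"
| "depth (Quant Q x \<phi>) = Suc (depth \<phi>)"

definition FO :: "'r vocabulary \<Rightarrow> 'a quantifier set \<Rightarrow> nat \<Rightarrow> ('a, 'r) formula set" where
  "FO \<tau> \<Q> d = {\<phi>. formula_over \<tau> \<Q> \<phi> \<and> depth \<phi> \<le> d}"

text \<open>Satisfaction is meaningful only if all free variables of the formula are in \<^term>\<open>dom f\<close>.\<close>

primrec sat :: "('a, 'r) model \<Rightarrow> 'a assignment \<Rightarrow> ('a, 'r) formula \<Rightarrow> bool" where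
  "sat A f (Eq x y) \<longleftrightarrow> the (f x) = the (f y)"
| "sat A f (Rel R xs) \<longleftrightarrow> map (\<lambda>x. the (f x)) xs \<in> interp A R"
| "sat A f (Neg \<phi>) \<longleftrightarrow> \<not> sat A f \<phi>"
| "sat A f (Conj \<phi> \<psi>) \<longleftrightarrow> sat A f \<phi> \<and> sat A f \<psi>"
| "sat A f (Disj \<phi> \<psi>) \<longleftrightarrow> sat A f \<phi> \<or> sat A f \<psi>"
| "sat A f (Quant Q x \<phi>) \<longleftrightarrow> (carrier A, {a \<in> carrier A. sat A (f(x \<mapsto> a)) \<phi>}) \<in> Q"

definition separable ::
  "'r vocabulary \<Rightarrow> 'a quantifier set \<Rightarrow> nat \<Rightarrow> ('a, 'r) model \<Rightarrow> 'a assignment \<Rightarrow>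
   ('a, 'r) model \<Rightarrow> 'a assignment \<Rightarrow> bool" where
  "separable \<tau> \<Q> d A f B g \<longleftrightarrow>
     (\<exists>\<phi> \<in> FO \<tau> \<Q> d. free_vars \<phi> \<subseteq> dom f \<and> free_vars \<phi> \<subseteq> dom g \<and> sat A f \<phi> \<and> \<not> sat B g \<phi>)"

fun is_atomic :: "('a, 'r) formula \<Rightarrow> bool" where
  "is_atomic (Eq x y) \<longleftrightarrow> True"
| "is_atomic (Rel R xs) \<longleftrightarrow> True"
| "is_atomic _ \<longleftrightarrow> False"


section \<open>The game\<close>

type_synonym ('a, 'r) position =
  "('a, 'r) model \<times> ('a, 'r) model \<times> 'a assignment \<times> 'a assignment"

fun partial_iso :: "'r vocabulary \<Rightarrow> ('a, 'r) position \<Rightarrow> bool" where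
  "partial_iso \<tau> (A, B, f, g) \<longleftrightarrow> dom f = dom g \<and>
     (\<forall>\<alpha> :: ('a, 'r) formula. is_atomic \<alpha> \<and> formula_over \<tau> {} \<alpha> \<and> free_vars \<alpha> \<subseteq> dom f \<longrightarrow>
        (sat A f \<alpha> \<longleftrightarrow> sat B g \<alpha>))"

datatype player = Player_I | Player_II

fun opponent :: "player \<Rightarrow> player" where
  "opponent Player_I = Player_II"
| "opponent Player_II = Player_I"

text \<open>
  The states of the game. The first two arguments of every constructor except \<open>Over\<close> are the player
  who is currently the attacker and the number of rounds to be played after the present one.
  In the argument lists, \<open>Q\<close>, \<open>x\<close>, \<open>X\<close>, \<open>P\<close>, \<open>X'\<close>, \<open>v'\<close> appear in the order in which they are
  chosen, and from \<open>Witness_Chosen\<close> on the position is oriented so that the witness set lies in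
  its first model.
\<close>

datatype ('a, 'r) state =
    Over (winner: player)
  | Round_Start player nat "('a, 'r) position"
  | Quantifier_Chosen player nat "('a, 'r) position" "'a quantifier" var
  | Witness_Chosen player nat "('a, 'r) position" "'a quantifier" var "'a set"
  | Witness_Accepted player nat "('a, 'r) position" "'a quantifier" var "'a set"
  | Spillover_Chosen player nat "('a, 'r) position" "'a quantifier" var "'a set" "'a set"
  | Answer_Chosen player nat "('a, 'r) position" var "'a set" "'a set" "'a set"
  | Element_Chosen player nat "('a, 'r) position" var "'a set" "'a set" 'a

fun turn :: "('a, 'r) state \<Rightarrow> player option" where
  "turn (Over w) = None"
| "turn (Round_Start att n p) = Some att"
| "turn (Quantifier_Chosen att n p Q x) = Some att"
| "turn (Witness_Chosen att n p Q x X) = Some (opponent att)"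
| "turn (Witness_Accepted att n p Q x X) = Some att"
| "turn (Spillover_Chosen att n p Q x X P) = Some (opponent att)"
| "turn (Answer_Chosen att n p x X P X') = Some att"
| "turn (Element_Chosen att n p x X P v') = Some (opponent att)"

text \<open>
  Two points of the bounded game admit more than one reading, and everything below is parametrized
  by the choice. If \<open>timeout_to_defender\<close> is false, then Player II wins whenever Player I has not won
  when the rounds run out, whatever the current roles are; if it is true, then the current defender
  wins (after an odd number of role swaps this is Player I). If \<open>initial_check\<close> is true, then an
  initial position that does not induce a partial isomorphism is won by Player I immediately, for
  every number of rounds; if it is false, then only for zero rounds.
\<close>

record bounded_rules =
  initial_check :: bool
  timeout_to_defender :: bool

text \<open>
  Step 5 of a round. The player \<open>att\<close> is the attacker after a possible role swap.
\<close>

definition end_round ::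
  "'r vocabulary \<Rightarrow> bounded_rules \<Rightarrow> player \<Rightarrow> nat \<Rightarrow> ('a, 'r) position \<Rightarrow> ('a, 'r) state" where
  "end_round \<tau> r att n p =
     (if \<not> partial_iso \<tau> p then Over att
      else case n of
        0 \<Rightarrow> Over (if timeout_to_defender r then opponent att else Player_II)
      | Suc m \<Rightarrow> Round_Start att m p)"

text \<open>
  After \<open>P\<close> or \<open>X'\<close> is chosen, the opposing player is also the one to make the next regular choice,
  so contesting is simply an alternative to that choice. After \<open>X\<close> is chosen, the next regular
  choice is the attacker's, so there is an explicit move for not contesting.
\<close>

inductive move ::
  "'r vocabulary \<Rightarrow> 'a quantifier set \<Rightarrow> bounded_rules \<Rightarrow> ('a, 'r) state \<Rightarrow> ('a, 'r) state \<Rightarrow> bool"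
  for \<tau> \<Q> r where
  choose_quantifier:
    "Q \<in> \<Q> \<Longrightarrow>
     move \<tau> \<Q> r (Round_Start att n p) (Quantifier_Chosen att n p Q x)"
| choose_witness:
    "(M, N, h, h') = (A, B, f, g) \<or> (M, N, h, h') = (B, A, g, f) \<Longrightarrow>
     X \<subseteq> carrier M \<Longrightarrow> (carrier M, X) \<in> Q \<Longrightarrow>
     move \<tau> \<Q> r (Quantifier_Chosen att n (A, B, f, g) Q x)
                (Witness_Chosen att n (M, N, h, h') Q x X)"
| contest_witness:
    "u \<in> X \<Longrightarrow> u' \<in> carrier M - X \<Longrightarrow>
     move \<tau> \<Q> r (Witness_Chosen att n (M, N, h, h') Q x X)
                (end_round \<tau> r att n (M, M, h(x \<mapsto> u), h(x \<mapsto> u')))"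
| accept_witness:
    "move \<tau> \<Q> r (Witness_Chosen att n p Q x X) (Witness_Accepted att n p Q x X)"
| choose_spillover:
    "P \<subseteq> carrier N \<Longrightarrow>
     move \<tau> \<Q> r (Witness_Accepted att n (M, N, h, h') Q x X)
                (Spillover_Chosen att n (M, N, h, h') Q x X P)"
| contest_spillover:
    "v' \<in> P \<Longrightarrow> v \<in> carrier M \<Longrightarrow>
     move \<tau> \<Q> r (Spillover_Chosen att n (M, N, h, h') Q x X P)
                (end_round \<tau> r att n (M, N, h(x \<mapsto> v), h'(x \<mapsto> v')))"
| choose_answer:
    "X' \<subseteq> carrier N \<Longrightarrow> (carrier N, X') \<in> Q \<Longrightarrow> P \<subseteq> X' \<Longrightarrow>
     move \<tau> \<Q> r (Spillover_Chosen att n (M, N, h, h') Q x X P)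
                (Answer_Chosen att n (M, N, h, h') x X P X')"
| contest_answer:
    "u \<in> X' \<Longrightarrow> u' \<in> carrier N - X' \<Longrightarrow>
     move \<tau> \<Q> r (Answer_Chosen att n (M, N, h, h') x X P X')
                (end_round \<tau> r (opponent att) n (N, N, h'(x \<mapsto> u), h'(x \<mapsto> u')))"
| choose_outside:
    "v' \<in> carrier N - X' \<Longrightarrow> v \<in> X \<Longrightarrow>
     move \<tau> \<Q> r (Answer_Chosen att n (M, N, h, h') x X P X')
                (end_round \<tau> r (opponent att) n (M, N, h(x \<mapsto> v), h'(x \<mapsto> v')))"
| choose_inside:
    "v' \<in> X' \<Longrightarrow>
     move \<tau> \<Q> r (Answer_Chosen att n p x X P X') (Element_Chosen att n p x X P v')"
| reply_witness:
    "v \<in> X \<Longrightarrow>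
     move \<tau> \<Q> r (Element_Chosen att n (M, N, h, h') x X P v')
                (end_round \<tau> r att n (M, N, h(x \<mapsto> v), h'(x \<mapsto> v')))"
| reply_spillover:
    "v \<in> P \<Longrightarrow>
     move \<tau> \<Q> r (Element_Chosen att n (M, N, h, h') x X P v')
                (end_round \<tau> r att n (N, N, [x \<mapsto> v], [x \<mapsto> v']))"

definition initial_state ::
  "'r vocabulary \<Rightarrow> bounded_rules \<Rightarrow> nat \<Rightarrow> ('a, 'r) position \<Rightarrow> ('a, 'r) state" where
  "initial_state \<tau> r d p =
     (case d of
        0 \<Rightarrow> Over (if partial_iso \<tau> p then Player_II else Player_I)
      | Suc n \<Rightarrow> if initial_check r \<and> \<not> partial_iso \<tau> p then Over Player_I
                 else Round_Start Player_I n p)"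

text \<open>
  A strategy maps the history of a play, a non-empty list ending in the current state, to the next
  state. \<open>play_with\<close> collects the histories in which player \<open>pl\<close> follows \<open>\<sigma>\<close>.
\<close>

type_synonym ('a, 'r) strategy = "('a, 'r) state list \<Rightarrow> ('a, 'r) state"

inductive play_with ::
  "'r vocabulary \<Rightarrow> 'a quantifier set \<Rightarrow> bounded_rules \<Rightarrow> player \<Rightarrow> ('a, 'r) strategy \<Rightarrow>
   ('a, 'r) state \<Rightarrow> ('a, 'r) state list \<Rightarrow> bool"
  for \<tau> \<Q> r pl \<sigma> s where
  start: "play_with \<tau> \<Q> r pl \<sigma> s [s]"
| own_move:
    "play_with \<tau> \<Q> r pl \<sigma> s hs \<Longrightarrow> turn (last hs) = Some pl \<Longrightarrow> move \<tau> \<Q> r (last hs) (\<sigma> hs) \<Longrightarrow>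
     play_with \<tau> \<Q> r pl \<sigma> s (hs @ [\<sigma> hs])"
| opponent_move:
    "play_with \<tau> \<Q> r pl \<sigma> s hs \<Longrightarrow> turn (last hs) = Some (opponent pl) \<Longrightarrow> move \<tau> \<Q> r (last hs) s' \<Longrightarrow>
     play_with \<tau> \<Q> r pl \<sigma> s (hs @ [s'])"

text \<open>
  All plays are finite, and a player who has to move but cannot loses. So \<open>\<sigma>\<close> is winning iff it
  always prescribes a legal move and no play that follows it ends in a win of the opponent.
\<close>

definition winning_strategy ::
  "'r vocabulary \<Rightarrow> 'a quantifier set \<Rightarrow> bounded_rules \<Rightarrow> player \<Rightarrow> ('a, 'r) state \<Rightarrow>
   ('a, 'r) strategy \<Rightarrow> bool" where
  "winning_strategy \<tau> \<Q> r pl s \<sigma> \<longleftrightarrow>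
     (\<forall>hs. play_with \<tau> \<Q> r pl \<sigma> s hs \<longrightarrow>
        (turn (last hs) = Some pl \<longrightarrow> move \<tau> \<Q> r (last hs) (\<sigma> hs)) \<and>
        (\<forall>w. last hs = Over w \<longrightarrow> w = pl))"

definition Player_I_wins_EF ::
  "'r vocabulary \<Rightarrow> 'a quantifier set \<Rightarrow> bounded_rules \<Rightarrow> nat \<Rightarrow> ('a, 'r) model \<Rightarrow> ('a, 'r) model \<Rightarrow>
   'a assignment \<Rightarrow> 'a assignment \<Rightarrow> bool" where
  "Player_I_wins_EF \<tau> \<Q> r d A B f g \<longleftrightarrow>
     (\<exists>\<sigma>. winning_strategy \<tau> \<Q> r Player_I (initial_state \<tau> r d (A, B, f, g)) \<sigma>)"

end

theory Submission
  imports Defs "HOL-Combinatorics.Transposition"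
begin

text \<open>
  Suppose that Player I wins with \<open>d + 1\<close> rounds to go and look at the winning choices of the
  first round: \<open>Q\<close>, \<open>x\<close>, a witness set \<open>X\<close> in \<open>(M, h)\<close> and a spillover set \<open>P\<close> in \<open>(N, k)\<close>.
  Say that two elements have the same type if the assignments \<open>h\<close> or \<open>k\<close>, extended by them at
  \<open>x\<close>, satisfy the same formulas of depth at most \<open>d\<close>. Since Player I also wins when these choices
  are contested, the induction hypothesis shows that no element of \<open>X\<close> has the type of an element
  of \<open>M\<close> outside \<open>X\<close>, and no element of \<open>P\<close> has the type of an element of \<open>M\<close>.

  There are only finitely many types, as the vocabulary and the set of quantifiers are finite
  (\<open>finite_definable\<close>). So one formula \<open>\<phi>\<close> of depth at most \<open>d\<close> says that \<open>x\<close> has the type of an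
  element of \<open>X\<close> or of \<open>P\<close> (\<open>union_of_types_definable\<close>), and \<open>\<phi>\<close> defines \<open>X\<close> in \<open>(M, h)\<close>.
  Hence \<open>Qx \<phi>\<close> holds in \<open>(M, h)\<close>. If it held in \<open>(N, k)\<close> as well, then the set defined by \<open>\<phi>\<close>
  in \<open>(N, k)\<close> would be a legal answer of the defender, and none of the attacker's continuations
  would be winning. If Player I picks one element satisfying \<open>\<phi>\<close> and one that does not, then
  the roles are swapped and \<open>\<phi>\<close> helps Player II, the new attacker. If Player I picks an element of
  the answer, then it has the type of an element of \<open>X\<close> or \<open>P\<close>, and Player II replies with that
  element. So \<open>Qx \<phi>\<close> separates the two sides.

  The induction hypothesis speaks about Player I as the attacker only. After a swap of roles it is
  used through \<open>not_both_roles\<close>: Player I cannot win a position in both roles, since the two plays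
  can be run against each other.
\<close>

section \<open>Winning and the moves of the game\<close>

definition wins ::
  "'r vocabulary \<Rightarrow> 'a quantifier set \<Rightarrow> bounded_rules \<Rightarrow> player \<Rightarrow> ('a, 'r) state \<Rightarrow> bool" where
  "wins \<tau> \<Q> r pl s \<longleftrightarrow> (\<exists>\<sigma>. winning_strategy \<tau> \<Q> r pl s \<sigma>)"

lemma play_with_nonempty: "play_with \<tau> \<Q> r pl \<sigma> s hs \<Longrightarrow> hs \<noteq> []"
  by (induction rule: play_with.induct) auto

lemma play_with_Cons:
  assumes "play_with \<tau> \<Q> r pl (\<lambda>hs. \<sigma> (s # hs)) s' hs"
    and "play_with \<tau> \<Q> r pl \<sigma> s [s, s']"
  shows "play_with \<tau> \<Q> r pl \<sigma> s (s # hs)"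
  using assms(1)
proof (induction rule: play_with.induct)
  case start
  show ?case by (fact assms(2))
next
  case (own_move hs)
  have "hs \<noteq> []" using own_move.hyps(1) by (rule play_with_nonempty)
  then show ?case
    using play_with.own_move[OF own_move.IH] own_move.hyps by simp
next
  case (opponent_move hs s'')
  have "hs \<noteq> []" using opponent_move.hyps(1) by (rule play_with_nonempty)
  then show ?case
    using play_with.opponent_move[OF opponent_move.IH, of s''] opponent_move.hyps by simp
qed

text \<open>
  What remains of a winning strategy after the first move is winning from there; it only has to
  be told that first state again, since strategies depend on the whole history.
\<close>

lemma winning_strategy_after_move:
  assumes "winning_strategy \<tau> \<Q> r pl s \<sigma>" and "play_with \<tau> \<Q> r pl \<sigma> s [s, s']"
  shows "wins \<tau> \<Q> r pl s'"
proof -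
  have "winning_strategy \<tau> \<Q> r pl s' (\<lambda>hs. \<sigma> (s # hs))"
    unfolding winning_strategy_def
  proof (intro allI impI)
    fix hs assume hs: "play_with \<tau> \<Q> r pl (\<lambda>hs. \<sigma> (s # hs)) s' hs"
    have "last (s # hs) = last hs" using play_with_nonempty[OF hs] by simp
    then show "(turn (last hs) = Some pl \<longrightarrow> move \<tau> \<Q> r (last hs) (\<sigma> (s # hs))) \<and>
        (\<forall>w. last hs = Over w \<longrightarrow> w = pl)"
      using assms(1) play_with_Cons[OF hs assms(2)] unfolding winning_strategy_def by metis
  qed
  then show ?thesis unfolding wins_def by blast
qed

lemma wins_own_move:
  assumes "wins \<tau> \<Q> r pl s" and "turn s = Some pl"
  obtains s' where "move \<tau> \<Q> r s s'" and "wins \<tau> \<Q> r pl s'"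
proof -
  obtain \<sigma> where \<sigma>: "winning_strategy \<tau> \<Q> r pl s \<sigma>" using assms(1) unfolding wins_def by blast
  have st: "play_with \<tau> \<Q> r pl \<sigma> s [s]" by (rule play_with.start)
  have m: "move \<tau> \<Q> r s (\<sigma> [s])"
    using \<sigma> st assms(2) unfolding winning_strategy_def by fastforce
  have "play_with \<tau> \<Q> r pl \<sigma> s [s, \<sigma> [s]]"
    using play_with.own_move[OF st] m assms(2) by simp
  then show thesis using that m winning_strategy_after_move[OF \<sigma>] by blast
qed

lemma wins_opponent_move:
  assumes "wins \<tau> \<Q> r pl s" and "turn s = Some (opponent pl)" and "move \<tau> \<Q> r s s'"
  shows "wins \<tau> \<Q> r pl s'"
proof -
  obtain \<sigma> where \<sigma>: "winning_strategy \<tau> \<Q> r pl s \<sigma>" using assms(1) unfolding wins_def by blast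
  have "play_with \<tau> \<Q> r pl \<sigma> s [s, s']"
    using play_with.opponent_move[OF play_with.start, of s pl \<tau> \<Q> r s'] assms(2,3) by simp
  then show ?thesis using winning_strategy_after_move[OF \<sigma>] by blast
qed

lemma wins_Over: "wins \<tau> \<Q> r pl (Over w) \<Longrightarrow> w = pl"
  unfolding wins_def winning_strategy_def
  by (metis last.simps play_with.start)

section \<open>Exchanging the roles of the players\<close>

fun swap_roles :: "('a, 'r) state \<Rightarrow> ('a, 'r) state" where
  "swap_roles (Over w) = Over (opponent w)"
| "swap_roles (Round_Start att n p) = Round_Start (opponent att) n p"
| "swap_roles (Quantifier_Chosen att n p Q x) = Quantifier_Chosen (opponent att) n p Q x"
| "swap_roles (Witness_Chosen att n p Q x X) = Witness_Chosen (opponent att) n p Q x X"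
| "swap_roles (Witness_Accepted att n p Q x X) = Witness_Accepted (opponent att) n p Q x X"
| "swap_roles (Spillover_Chosen att n p Q x X P) = Spillover_Chosen (opponent att) n p Q x X P"
| "swap_roles (Answer_Chosen att n p x X P X') = Answer_Chosen (opponent att) n p x X P X'"
| "swap_roles (Element_Chosen att n p x X P v') = Element_Chosen (opponent att) n p x X P v'"

text \<open>
  The game is not symmetric under \<^const>\<open>swap_roles\<close> if an expired game goes to Player II
  regardless of the roles. The second disjunct covers this: all that matters at the end is that
  Player I does not win in both roles.
\<close>

definition opposed :: "('a, 'r) state \<Rightarrow> ('a, 'r) state \<Rightarrow> bool" where
  "opposed s t \<longleftrightarrow> t = swap_roles s \<or>
     (\<exists>w w'. s = Over w \<and> t = Over w' \<and> (w = Player_II \<or> w' = Player_II))"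

lemma opponent_opponent [simp]: "opponent (opponent pl) = pl"
  by (cases pl) auto

lemma swap_roles_swap_roles [simp]: "swap_roles (swap_roles s) = s"
  by (cases s) auto

lemma opposed_sym: "opposed s t \<Longrightarrow> opposed t s"
  unfolding opposed_def by auto

lemma opposed_swap_roles: "opposed s (swap_roles s)"
  unfolding opposed_def by simp

lemma opposed_end_round:
  "opposed (end_round \<tau> r att n p) (end_round \<tau> r (opponent att) n p)"
  unfolding end_round_def opposed_def by (cases n; cases att) auto

lemma opposed_move:
  assumes "move \<tau> \<Q> r s s'"
  shows "\<exists>t'. move \<tau> \<Q> r (swap_roles s) t' \<and> opposed s' t'"
  using assms
proof cases
  case choose_quantifier
  then show ?thesis using opposed_swap_roles[of s']
    by (intro exI[of _ "swap_roles s'"]) (auto intro: move.choose_quantifier)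
next
  case choose_witness
  then show ?thesis using opposed_swap_roles[of s']
    by (intro exI[of _ "swap_roles s'"]) (auto intro: move.choose_witness)
next
  case contest_witness
  then show ?thesis using opposed_end_round by (auto intro!: exI move.contest_witness)
next
  case accept_witness
  then show ?thesis using opposed_swap_roles[of s']
    by (intro exI[of _ "swap_roles s'"]) (auto intro: move.accept_witness)
next
  case choose_spillover
  then show ?thesis using opposed_swap_roles[of s']
    by (intro exI[of _ "swap_roles s'"]) (auto intro: move.choose_spillover)
next
  case contest_spillover
  then show ?thesis using opposed_end_round by (auto intro!: exI move.contest_spillover)
next
  case choose_answer
  then show ?thesis using opposed_swap_roles[of s']
    by (intro exI[of _ "swap_roles s'"]) (auto intro: move.choose_answer)
next
  case contest_answer
  then show ?thesis using opposed_sym[OF opposed_end_round]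
    by (auto intro!: exI move.contest_answer)
next
  case choose_outside
  then show ?thesis using opposed_sym[OF opposed_end_round]
    by (auto intro!: exI move.choose_outside)
next
  case choose_inside
  then show ?thesis using opposed_swap_roles[of s']
    by (intro exI[of _ "swap_roles s'"]) (auto intro: move.choose_inside)
next
  case reply_witness
  then show ?thesis using opposed_end_round by (auto intro!: exI move.reply_witness)
next
  case reply_spillover
  then show ?thesis using opposed_end_round by (auto intro!: exI move.reply_spillover)
qed

text \<open>A bound on the number of remaining moves: a round consists of at most seven.\<close>

fun moves_left :: "('a, 'r) state \<Rightarrow> nat" where
  "moves_left (Over w) = 0"
| "moves_left (Round_Start att n p) = 7 * n + 7"
| "moves_left (Quantifier_Chosen att n p Q x) = 7 * n + 6"
| "moves_left (Witness_Chosen att n p Q x X) = 7 * n + 5"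
| "moves_left (Witness_Accepted att n p Q x X) = 7 * n + 4"
| "moves_left (Spillover_Chosen att n p Q x X P) = 7 * n + 3"
| "moves_left (Answer_Chosen att n p x X P X') = 7 * n + 2"
| "moves_left (Element_Chosen att n p x X P v') = 7 * n + 1"

lemma moves_left_end_round: "moves_left (end_round \<tau> r att n p) \<le> 7 * n"
  unfolding end_round_def by (cases n) auto

lemma moves_left_decreases: "move \<tau> \<Q> r s s' \<Longrightarrow> moves_left s' < moves_left s"
  by (induction rule: move.induct)
    (auto intro: le_less_trans[OF moves_left_end_round])

lemma turn_swap_roles: "turn (swap_roles s) = map_option opponent (turn s)"
  by (cases s) auto

lemma turn_None: "turn s = None \<Longrightarrow> \<exists>w. s = Over w"
  by (cases s) auto

text \<open>
  If Player I could win from both states, then the two strategies could be played against each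
  other: whenever Player I moves in one of the plays, Player II copies this move in the other one.
  Player I would win both plays, but the two outcomes are opposed.
\<close>

lemma not_both_roles:
  assumes "opposed s t" and "wins \<tau> \<Q> r Player_I s" and "wins \<tau> \<Q> r Player_I t"
  shows False
  using assms
proof (induction "moves_left s" arbitrary: s t rule: less_induct)
  case less
  show ?case
  proof (cases "turn s")
    case None
    then obtain w where s: "s = Over w" using turn_None by blast
    then obtain w' where t: "t = Over w'" using less.prems(1) unfolding opposed_def by auto
    have "w = Player_I" "w' = Player_I"
      using wins_Over less.prems(2,3) unfolding s t by metis+
    then show ?thesis using less.prems(1) s t unfolding opposed_def by auto
  next
    case (Some pl)
    then have t: "t = swap_roles s" using less.prems(1) unfolding opposed_def by auto
    then have turn_t: "turn t = Some (opponent pl)" using Some by (simp add: turn_swap_roles)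
    show ?thesis
    proof (cases pl)
      case Player_I
      then obtain s' where s': "move \<tau> \<Q> r s s'" "wins \<tau> \<Q> r Player_I s'"
        using wins_own_move less.prems(2) Some by metis
      then obtain t' where "move \<tau> \<Q> r t t'" "opposed s' t'"
        using opposed_move t by blast
      then show ?thesis
        using less.hyps[of s' t'] s' moves_left_decreases wins_opponent_move[OF less.prems(3)]
          turn_t Player_I by blast
    next
      case Player_II
      then obtain t' where t': "move \<tau> \<Q> r t t'" "wins \<tau> \<Q> r Player_I t'"
        using wins_own_move less.prems(3) turn_t by (metis opponent.simps(2))
      then obtain s' where "move \<tau> \<Q> r s s'" "opposed t' s'"
        using opposed_move t swap_roles_swap_roles by metis
      then show ?thesis
        using less.hyps[of s' t'] t' moves_left_decreases wins_opponent_move[OF less.prems(2)]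
          Some Player_II opposed_sym by (metis opponent.simps(1))
    qed
  qed
qed

section \<open>Finitely many definable properties\<close>

lemma sat_cong:
  "(\<And>y. y \<in> free_vars \<phi> \<Longrightarrow> h y = k y) \<Longrightarrow> sat M h \<phi> \<longleftrightarrow> sat M k \<phi>"
proof (induction \<phi> arbitrary: h k)
  case (Rel R xs)
  then have "map (\<lambda>x. the (h x)) xs = map (\<lambda>x. the (k x)) xs" by simp
  then show ?case by (simp only: sat.simps)
next
  case (Quant Q x \<phi>)
  have "sat M (h(x \<mapsto> a)) \<phi> \<longleftrightarrow> sat M (k(x \<mapsto> a)) \<phi>" for a
    using Quant.prems by (intro Quant.IH) auto
  then show ?case by simp
next
  case (Neg \<phi>)
  show ?case using Neg.IH[of h k] Neg.prems by simp
next
  case (Conj \<phi> \<psi>)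
  show ?case using Conj.IH[of h k] Conj.prems by simp
next
  case (Disj \<phi> \<psi>)
  show ?case using Disj.IH[of h k] Disj.prems by simp
qed simp

text \<open>
  Bound variables are renamed along with the free ones. For injective renamings no variable is
  captured, and this is all that is needed to replace a bound variable by a fresh one.
\<close>

primrec rename :: "(var \<Rightarrow> var) \<Rightarrow> ('a, 'r) formula \<Rightarrow> ('a, 'r) formula" where
  "rename \<pi> (Eq x y) = Eq (\<pi> x) (\<pi> y)"
| "rename \<pi> (Rel R xs) = Rel R (map \<pi> xs)"
| "rename \<pi> (Neg \<phi>) = Neg (rename \<pi> \<phi>)"
| "rename \<pi> (Conj \<phi> \<psi>) = Conj (rename \<pi> \<phi>) (rename \<pi> \<psi>)"
| "rename \<pi> (Disj \<phi> \<psi>) = Disj (rename \<pi> \<phi>) (rename \<pi> \<psi>)"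
| "rename \<pi> (Quant Q x \<phi>) = Quant Q (\<pi> x) (rename \<pi> \<phi>)"

lemma sat_rename:
  assumes "inj \<pi>"
  shows "sat M h (rename \<pi> \<phi>) \<longleftrightarrow> sat M (h \<circ> \<pi>) \<phi>"
proof (induction \<phi> arbitrary: h)
  case (Quant Q x \<phi>)
  have "h(\<pi> x \<mapsto> a) \<circ> \<pi> = (h \<circ> \<pi>)(x \<mapsto> a)" for a
    using assms by (auto simp: fun_eq_iff inj_eq)
  then show ?case by (simp only: rename.simps sat.simps Quant.IH)
qed (simp_all add: comp_def)

lemma free_vars_rename: "inj \<pi> \<Longrightarrow> free_vars (rename \<pi> \<phi>) = \<pi> ` free_vars \<phi>"
  by (induction \<phi>) (auto simp: image_Un image_set_diff)

lemma depth_rename [simp]: "depth (rename \<pi> \<phi>) = depth \<phi>"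
  by (induction \<phi>) auto

lemma formula_over_rename [simp]: "formula_over \<tau> \<Q> (rename \<pi> \<phi>) \<longleftrightarrow> formula_over \<tau> \<Q> \<phi>"
  by (induction \<phi>) auto

definition property :: "('a, 'r) formula \<Rightarrow> (('a, 'r) model \<times> 'a assignment) set" where
  "property \<phi> = {(M, h). sat M h \<phi>}"

definition FO_on ::
  "'r vocabulary \<Rightarrow> 'a quantifier set \<Rightarrow> nat \<Rightarrow> var set \<Rightarrow> ('a, 'r) formula set" where
  "FO_on \<tau> \<Q> d V = {\<phi> \<in> FO \<tau> \<Q> d. free_vars \<phi> \<subseteq> V}"

definition atoms_on :: "'r vocabulary \<Rightarrow> var set \<Rightarrow> ('a, 'r) formula set" where
  "atoms_on \<tau> V = {\<alpha>. is_atomic \<alpha> \<and> formula_over \<tau> {} \<alpha> \<and> free_vars \<alpha> \<subseteq> V}"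

definition quants_on ::
  "'r vocabulary \<Rightarrow> 'a quantifier set \<Rightarrow> nat \<Rightarrow> var set \<Rightarrow> ('a, 'r) formula set" where
  "quants_on \<tau> \<Q> d V = {Quant Q x \<psi> |Q x \<psi>. Quant Q x \<psi> \<in> FO_on \<tau> \<Q> d V}"

text \<open>
  Whether a formula holds depends only on which of its atomic and quantified subformulas outside
  of all quantifiers hold, and there are finitely many truth assignments to finitely many of them.
\<close>

lemma finite_properties_from_basic:
  assumes "finite (property ` (atoms_on \<tau> V \<union> quants_on \<tau> \<Q> d V))"
  shows "finite (property ` FO_on \<tau> \<Q> d V)"
proof -
  define G where "G = property ` (atoms_on \<tau> V \<union> quants_on \<tau> \<Q> d V)"
  define trace where "trace m = {S \<in> G. m \<in> S}" for m
  have all: "trace -` Pow G = UNIV" unfolding trace_def by auto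
  have basic: "\<exists>T \<subseteq> Pow G. S = trace -` T" if "S \<in> G" for S
    using that by (intro exI[of _ "{U \<in> Pow G. S \<in> U}"]) (auto simp: trace_def)
  have "\<exists>T \<subseteq> Pow G. property \<phi> = trace -` T"
    if "formula_over \<tau> \<Q> \<phi>" "depth \<phi> \<le> d" "free_vars \<phi> \<subseteq> V" for \<phi>
    using that
  proof (induction \<phi>)
    case (Eq x y)
    then have "property (Eq x y) \<in> G" unfolding G_def atoms_on_def by (intro imageI) auto
    then show ?case by (rule basic)
  next
    case (Rel R xs)
    then have "property (Rel R xs) \<in> G" unfolding G_def atoms_on_def by (intro imageI) auto
    then show ?case by (rule basic)
  next
    case (Quant Q x \<phi>)
    then have "Quant Q x \<phi> \<in> FO_on \<tau> \<Q> d V" unfolding FO_on_def FO_def by simp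
    then have "property (Quant Q x \<phi>) \<in> G" unfolding G_def quants_on_def by blast
    then show ?case by (rule basic)
  next
    case (Neg \<phi>)
    then obtain T where T: "T \<subseteq> Pow G" "property \<phi> = trace -` T" by auto
    have "property (Neg \<phi>) = - property \<phi>" unfolding property_def by auto
    then have "property (Neg \<phi>) = trace -` (Pow G - T)"
      using T(2) all by (simp add: vimage_Diff Compl_eq_Diff_UNIV)
    then show ?case by (intro exI[of _ "Pow G - T"] conjI Diff_subset)
  next
    case (Conj \<phi> \<psi>)
    then obtain T U where TU: "T \<subseteq> Pow G" "property \<phi> = trace -` T"
      and "U \<subseteq> Pow G" "property \<psi> = trace -` U" by auto
    moreover have "property (Conj \<phi> \<psi>) = property \<phi> \<inter> property \<psi>"
      unfolding property_def by auto
    ultimately have "property (Conj \<phi> \<psi>) = trace -` (T \<inter> U)" by (simp add: vimage_Int)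
    then show ?case using TU(1) by (intro exI[of _ "T \<inter> U"] conjI le_infI1)
  next
    case (Disj \<phi> \<psi>)
    then obtain T U where TU: "T \<subseteq> Pow G" "U \<subseteq> Pow G"
      and "property \<phi> = trace -` T" "property \<psi> = trace -` U" by auto
    moreover have "property (Disj \<phi> \<psi>) = property \<phi> \<union> property \<psi>"
      unfolding property_def by auto
    ultimately have "property (Disj \<phi> \<psi>) = trace -` (T \<union> U)" by (simp add: vimage_Un)
    then show ?case using TU by (intro exI[of _ "T \<union> U"] conjI Un_least)
  qed
  then have "\<forall>\<phi> \<in> FO_on \<tau> \<Q> d V. \<exists>T \<subseteq> Pow G. property \<phi> = trace -` T"
    unfolding FO_on_def FO_def by simp
  then have "property ` FO_on \<tau> \<Q> d V \<subseteq> (\<lambda>T. trace -` T) ` Pow (Pow G)"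
    by (simp only: image_subset_iff image_iff Pow_iff Bex_def)
  moreover have "finite ((\<lambda>T. trace -` T) ` Pow (Pow G))"
    using assms unfolding G_def by simp
  ultimately show ?thesis by (rule finite_subset)
qed

lemma finite_atoms_on:
  fixes \<tau> :: "'r vocabulary"
  assumes "finite (dom \<tau>)" and "finite V"
  shows "finite (atoms_on \<tau> V :: ('a, 'r) formula set)"
proof -
  have "(atoms_on \<tau> V :: ('a, 'r) formula set) \<subseteq> (\<lambda>(x, y). Eq x y) ` (V \<times> V) \<union>
      (\<Union>R \<in> dom \<tau>. Rel R ` {xs. set xs \<subseteq> V \<and> length xs = the (\<tau> R)})" (is "_ \<subseteq> ?F")
  proof
    fix \<alpha> :: "('a, 'r) formula" assume "\<alpha> \<in> atoms_on \<tau> V"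
    then show "\<alpha> \<in> ?F" unfolding atoms_on_def by (cases \<alpha>) force+
  qed
  moreover have "finite ?F"
    using assms finite_lists_length_eq[OF assms(2)] by auto
  ultimately show ?thesis by (rule finite_subset)
qed

text \<open>
  A bound variable outside of \<open>V\<close> may be exchanged with any other variable outside of \<open>V\<close>, so one
  such variable is enough.
\<close>

lemma quant_fresh_variable:
  assumes "x \<notin> V" and "z \<notin> V" and \<psi>: "Quant Q x \<psi> \<in> FO_on \<tau> \<Q> (Suc d) V"
  obtains \<psi>' where "\<psi>' \<in> FO_on \<tau> \<Q> d (insert z V)"
    and "property (Quant Q x \<psi>) = property (Quant Q z \<psi>')"
proof
  let ?\<pi> = "transpose x z"
  have inj: "inj ?\<pi>" by (rule inj_transpose)
  have fv: "free_vars \<psi> \<subseteq> insert x V" using \<psi> unfolding FO_on_def by auto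
  have fix_V: "?\<pi> y = y" if "y \<in> V" for y
    using that assms(1,2) by (metis transpose_apply_other)
  have "?\<pi> y \<in> insert z V" if "y \<in> free_vars \<psi>" for y
    using that fv fix_V by (cases "y = x") (simp, metis insertE insertI2 subsetD)
  then have "free_vars (rename ?\<pi> \<psi>) \<subseteq> insert z V"
    unfolding free_vars_rename[OF inj] by (rule image_subsetI)
  then show "rename ?\<pi> \<psi> \<in> FO_on \<tau> \<Q> d (insert z V)"
    using \<psi> unfolding FO_on_def FO_def by simp
  have "sat M (h(x \<mapsto> a)) \<psi> \<longleftrightarrow> sat M (h(z \<mapsto> a)) (rename ?\<pi> \<psi>)" for M h a
    unfolding sat_rename[OF inj]
  proof (rule sat_cong)
    fix y assume "y \<in> free_vars \<psi>"
    then consider "y = x" | "y \<in> V" "y \<noteq> x" "y \<noteq> z" using fv assms(1,2) by blast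
    then show "(h(x \<mapsto> a)) y = (h(z \<mapsto> a) \<circ> ?\<pi>) y" by cases (simp_all add: fix_V)
  qed
  then show "property (Quant Q x \<psi>) = property (Quant Q z (rename ?\<pi> \<psi>))"
    unfolding property_def by (simp only: sat.simps)
qed

text \<open>
  By induction on the depth: the property expressed by \<open>Qx \<psi>\<close> is determined by \<open>Q\<close>, \<open>x\<close> and the
  property expressed by \<open>\<psi>\<close>, and \<open>x\<close> may be taken from \<open>V\<close> and one fresh variable.
\<close>

lemma finite_definable:
  fixes \<tau> :: "'r vocabulary" and \<Q> :: "'a quantifier set"
  assumes "finite (dom \<tau>)" and "finite \<Q>" and "finite V"
  shows "finite (property ` FO_on \<tau> \<Q> d V)"
  using assms(3)
proof (induction d arbitrary: V)
  case 0
  have "quants_on \<tau> \<Q> 0 V = {}" unfolding quants_on_def FO_on_def FO_def by auto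
  then show ?case
    by (intro finite_properties_from_basic) (simp add: finite_atoms_on[OF assms(1) 0])
next
  case (Suc d)
  obtain z where z: "z \<notin> V" using ex_new_if_finite[OF infinite_UNIV_nat Suc.prems] by blast
  define quantify :: "'a quantifier \<Rightarrow> var \<Rightarrow>
      (('a, 'r) model \<times> 'a assignment) set \<Rightarrow> (('a, 'r) model \<times> 'a assignment) set"
    where "quantify Q x S =
      {(M, h). (carrier M, {a \<in> carrier M. (M, h(x \<mapsto> a)) \<in> S}) \<in> Q}" for Q x S
  have quantify: "property (Quant Q x \<psi>) = quantify Q x (property \<psi>)" for Q x \<psi>
    unfolding property_def quantify_def by simp
  let ?F = "\<Union>Q \<in> \<Q>. \<Union>x \<in> insert z V. quantify Q x ` (property ` FO_on \<tau> \<Q> d (insert x V))"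
  have "property ` quants_on \<tau> \<Q> (Suc d) V \<subseteq> ?F"
  proof
    fix S assume "S \<in> property ` quants_on \<tau> \<Q> (Suc d) V"
    then obtain Q x \<psi> where S: "S = property (Quant Q x \<psi>)"
      and \<psi>: "Quant Q x \<psi> \<in> FO_on \<tau> \<Q> (Suc d) V"
      unfolding quants_on_def by blast
    have Q: "Q \<in> \<Q>" using \<psi> unfolding FO_on_def FO_def by simp
    have "\<exists>y \<in> insert z V. \<exists>\<psi>' \<in> FO_on \<tau> \<Q> d (insert y V). S = property (Quant Q y \<psi>')"
    proof (cases "x \<in> V")
      case True
      have "\<psi> \<in> FO_on \<tau> \<Q> d (insert x V)" using \<psi> unfolding FO_on_def FO_def by auto
      then show ?thesis using True S by blast
    next
      case False
      then show ?thesis using quant_fresh_variable[OF False z \<psi>] S by (metis insertI1)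
    qed
    then obtain y \<psi>' where y: "y \<in> insert z V" "\<psi>' \<in> FO_on \<tau> \<Q> d (insert y V)"
      and S': "S = quantify Q y (property \<psi>')"
      unfolding quantify by blast
    have "S \<in> quantify Q y ` (property ` FO_on \<tau> \<Q> d (insert y V))"
      unfolding S' using y(2) by (rule imageI[OF imageI])
    then show "S \<in> ?F" by (rule UN_I[OF Q UN_I[OF y(1)]])
  qed
  moreover have "finite ?F"
  proof (intro finite_UN_I)
    show "finite (quantify Q y ` (property ` FO_on \<tau> \<Q> d (insert y V)))" for Q y
      using Suc.prems by (intro finite_imageI[OF Suc.IH]) simp
  qed (use Suc.prems assms(2) in simp_all)
  ultimately have "finite (property ` quants_on \<tau> \<Q> (Suc d) V)" by (rule finite_subset)
  then show ?case
    by (intro finite_properties_from_basic)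
      (simp add: image_Un finite_atoms_on[OF assms(1) Suc.prems])
qed

section \<open>Separability and types\<close>

lemma FO_on_Neg: "\<phi> \<in> FO_on \<tau> \<Q> d V \<Longrightarrow> Neg \<phi> \<in> FO_on \<tau> \<Q> d V"
  unfolding FO_on_def FO_def by simp

lemma separable_iff:
  assumes "dom h = V" and "dom k = V"
  shows "separable \<tau> \<Q> d M h N k \<longleftrightarrow> (\<exists>\<phi> \<in> FO_on \<tau> \<Q> d V. sat M h \<phi> \<noteq> sat N k \<phi>)"
proof
  assume "\<exists>\<phi> \<in> FO_on \<tau> \<Q> d V. sat M h \<phi> \<noteq> sat N k \<phi>"
  then obtain \<phi> where \<phi>: "\<phi> \<in> FO_on \<tau> \<Q> d V" "sat M h \<phi> \<noteq> sat N k \<phi>" by blast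
  then have "\<exists>\<phi> \<in> FO_on \<tau> \<Q> d V. sat M h \<phi> \<and> \<not> sat N k \<phi>"
    using FO_on_Neg[OF \<phi>(1)] by (metis sat.simps(3))
  then show "separable \<tau> \<Q> d M h N k"
    unfolding separable_def FO_on_def using assms by blast
next
  assume "separable \<tau> \<Q> d M h N k"
  then show "\<exists>\<phi> \<in> FO_on \<tau> \<Q> d V. sat M h \<phi> \<noteq> sat N k \<phi>"
    unfolding separable_def FO_on_def using assms by blast
qed

lemma separable_sym:
  "dom h = dom k \<Longrightarrow> separable \<tau> \<Q> d M h N k \<Longrightarrow> separable \<tau> \<Q> d N k M h"
  using separable_iff[of h "dom h" k] separable_iff[of k "dom h" h] by metis

lemma formula_over_atomic: "is_atomic \<alpha> \<Longrightarrow> formula_over \<tau> {} \<alpha> \<Longrightarrow> formula_over \<tau> \<Q> \<alpha>"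
  by (cases \<alpha>) auto

lemma depth_atomic: "is_atomic \<alpha> \<Longrightarrow> depth \<alpha> = 0"
  by (cases \<alpha>) auto

lemma not_partial_iso_separable:
  fixes M N :: "('a, 'r) model" and \<tau> :: "'r vocabulary"
  assumes "dom h = dom k" and "\<not> partial_iso \<tau> (M, N, h, k)"
  shows "separable \<tau> \<Q> d M h N k"
proof -
  obtain \<alpha> :: "('a, 'r) formula" where \<alpha>: "is_atomic \<alpha>" "formula_over \<tau> {} \<alpha>"
      "free_vars \<alpha> \<subseteq> dom h" "sat M h \<alpha> \<noteq> sat N k \<alpha>"
    using assms by auto
  then have "\<alpha> \<in> FO_on \<tau> \<Q> d (dom h)"
    unfolding FO_on_def FO_def using formula_over_atomic depth_atomic by fastforce
  then show ?thesis using separable_iff[of h "dom h" k] assms(1) \<alpha>(4) by metis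
qed

text \<open>Non-emptiness of \<open>V\<close> provides the formula \<open>x = x\<close> for the empty conjunction.\<close>

lemma finite_conjunction:
  assumes "finite \<Phi>" and "\<Phi> \<subseteq> FO_on \<tau> \<Q> d V" and "x \<in> V"
  shows "\<exists>\<chi> \<in> FO_on \<tau> \<Q> d V. \<forall>M h. sat M h \<chi> \<longleftrightarrow> (\<forall>\<phi> \<in> \<Phi>. sat M h \<phi>)"
  using assms(1,2)
proof (induction \<Phi> rule: finite_induct)
  case empty
  have "Eq x x \<in> FO_on \<tau> \<Q> d V" using assms(3) unfolding FO_on_def FO_def by simp
  then show ?case by (intro bexI) auto
next
  case (insert \<phi> \<Phi>)
  then obtain \<chi> where \<chi>: "\<chi> \<in> FO_on \<tau> \<Q> d V"
      "\<And>M h. sat M h \<chi> \<longleftrightarrow> (\<forall>\<phi> \<in> \<Phi>. sat M h \<phi>)" by blast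
  have "Conj \<phi> \<chi> \<in> FO_on \<tau> \<Q> d V" using \<chi>(1) insert.prems unfolding FO_on_def FO_def by simp
  then show ?case using \<chi>(2) by (intro bexI[of _ "Conj \<phi> \<chi>"]) auto
qed

lemma finite_disjunction:
  assumes "finite \<Phi>" and "\<Phi> \<subseteq> FO_on \<tau> \<Q> d V" and "x \<in> V"
  shows "\<exists>\<chi> \<in> FO_on \<tau> \<Q> d V. \<forall>M h. sat M h \<chi> \<longleftrightarrow> (\<exists>\<phi> \<in> \<Phi>. sat M h \<phi>)"
proof -
  have "Neg ` \<Phi> \<subseteq> FO_on \<tau> \<Q> d V" using assms(2) FO_on_Neg by blast
  then obtain \<chi> where \<chi>: "\<chi> \<in> FO_on \<tau> \<Q> d V"
      "\<And>M h. sat M h \<chi> \<longleftrightarrow> (\<forall>\<phi> \<in> Neg ` \<Phi>. sat M h \<phi>)"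
    using finite_conjunction[of "Neg ` \<Phi>"] assms(1,3) by (metis finite_imageI)
  then show ?thesis by (intro bexI[of _ "Neg \<chi>"]) (auto simp: FO_on_Neg)
qed

text \<open>
  By finiteness each type is given by a single formula, the conjunction of representatives of all
  properties that it contains; and every set of types is finite, so its union is a disjunction.
\<close>

lemma union_of_types_definable:
  fixes \<tau> :: "'r vocabulary" and \<Q> :: "'a quantifier set"
  assumes "finite (dom \<tau>)" and "finite \<Q>" and "finite V" and "x \<in> V"
    and K: "\<And>N k. (N, k) \<in> K \<Longrightarrow> dom k = V"
  obtains \<phi> where "\<phi> \<in> FO_on \<tau> \<Q> d V"
    and "\<And>M h. dom h = V \<Longrightarrow>
      sat M h \<phi> \<longleftrightarrow> (\<exists>(N, k) \<in> K. \<not> separable \<tau> \<Q> d N k M h)"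
proof -
  obtain \<Phi> where \<Phi>: "\<Phi> \<subseteq> FO_on \<tau> \<Q> d V" "finite \<Phi>" "property ` FO_on \<tau> \<Q> d V = property ` \<Phi>"
    using finite_subset_image[OF finite_definable[OF assms(1-3)] subset_refl] by metis
  have rep: "\<exists>\<psi> \<in> \<Phi>. \<forall>M h. sat M h \<phi> \<longleftrightarrow> sat M h \<psi>" if \<phi>: "\<phi> \<in> FO_on \<tau> \<Q> d V" for \<phi>
  proof -
    obtain \<psi> where \<psi>: "\<psi> \<in> \<Phi>" "property \<phi> = property \<psi>" using \<phi> \<Phi>(3) by blast
    have "sat M h \<phi> \<longleftrightarrow> sat M h \<psi>" for M h
      using \<psi>(2) unfolding property_def by (simp add: set_eq_iff)
    then show ?thesis using \<psi>(1) by blast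
  qed
  define type_of where "type_of = (\<lambda>(N, k). {\<psi> \<in> \<Phi>. sat N k \<psi>})"
  have "\<forall>T. \<exists>\<chi>. T \<subseteq> \<Phi> \<longrightarrow>
      \<chi> \<in> FO_on \<tau> \<Q> d V \<and> (\<forall>M h. sat M h \<chi> \<longleftrightarrow> (\<forall>\<psi> \<in> T. sat M h \<psi>))"
  proof
    fix T
    show "\<exists>\<chi>. T \<subseteq> \<Phi> \<longrightarrow>
      \<chi> \<in> FO_on \<tau> \<Q> d V \<and> (\<forall>M h. sat M h \<chi> \<longleftrightarrow> (\<forall>\<psi> \<in> T. sat M h \<psi>))"
    proof (cases "T \<subseteq> \<Phi>")
      case True
      then show ?thesis
        using finite_conjunction[OF finite_subset[OF True \<Phi>(2)] subset_trans[OF True \<Phi>(1)] assms(4)]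
        by (elim bexE) (intro exI impI conjI)
    qed simp
  qed
  from choice[OF this] obtain \<chi> where \<chi>_all: "\<forall>T. T \<subseteq> \<Phi> \<longrightarrow>
      \<chi> T \<in> FO_on \<tau> \<Q> d V \<and> (\<forall>M h. sat M h (\<chi> T) \<longleftrightarrow> (\<forall>\<psi> \<in> T. sat M h \<psi>))"
    by (rule exE)
  have \<chi>: "\<chi> T \<in> FO_on \<tau> \<Q> d V" "sat M h (\<chi> T) \<longleftrightarrow> (\<forall>\<psi> \<in> T. sat M h \<psi>)"
    if "T \<subseteq> \<Phi>" for T M h
    using \<chi>_all that by simp_all
  have sub: "type_of m \<subseteq> \<Phi>" for m unfolding type_of_def by (cases m) auto
  then have "type_of ` K \<subseteq> Pow \<Phi>" by blast
  then have "finite (type_of ` K)" by (rule finite_subset) (simp add: \<Phi>(2))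
  then have "finite (\<chi> ` type_of ` K)" by (rule finite_imageI)
  moreover have "\<chi> ` type_of ` K \<subseteq> FO_on \<tau> \<Q> d V" using \<chi>(1) sub by blast
  ultimately have "\<exists>\<phi> \<in> FO_on \<tau> \<Q> d V.
      \<forall>M h. sat M h \<phi> \<longleftrightarrow> (\<exists>\<psi> \<in> \<chi> ` type_of ` K. sat M h \<psi>)"
    by (rule finite_disjunction[OF _ _ assms(4)])
  then obtain \<phi> where \<phi>: "\<phi> \<in> FO_on \<tau> \<Q> d V"
      "\<forall>M h. sat M h \<phi> \<longleftrightarrow> (\<exists>\<psi> \<in> \<chi> ` type_of ` K. sat M h \<psi>)"
    by (rule bexE)
  have type: "sat M h (\<chi> (type_of (N, k))) \<longleftrightarrow> \<not> separable \<tau> \<Q> d N k M h"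
    if "dom k = V" "dom h = V" for M h N k
  proof -
    have "sat M h (\<chi> (type_of (N, k))) \<longleftrightarrow> (\<forall>\<psi> \<in> \<Phi>. sat N k \<psi> \<longrightarrow> sat M h \<psi>)"
      unfolding \<chi>(2)[OF sub] by (simp add: type_of_def Ball_def imp_conjL)
    also have "\<dots> \<longleftrightarrow> (\<forall>\<psi> \<in> FO_on \<tau> \<Q> d V. sat N k \<psi> \<longrightarrow> sat M h \<psi>)"
    proof (intro iffI ballI)
      fix \<psi> assume all: "\<forall>\<psi> \<in> \<Phi>. sat N k \<psi> \<longrightarrow> sat M h \<psi>" and "\<psi> \<in> FO_on \<tau> \<Q> d V"
      then obtain \<psi>' where "\<psi>' \<in> \<Phi>" "\<forall>M h. sat M h \<psi> \<longleftrightarrow> sat M h \<psi>'" using rep by metis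
      then show "sat N k \<psi> \<longrightarrow> sat M h \<psi>" using all by simp
    qed (use \<Phi>(1) in auto)
    also have "\<dots> \<longleftrightarrow> \<not> separable \<tau> \<Q> d N k M h"
      unfolding separable_def FO_on_def using that by auto
    finally show ?thesis .
  qed
  show thesis
  proof (rule that[OF \<phi>(1)])
    fix M :: "('a, 'r) model" and h :: "'a assignment" assume h: "dom h = V"
    have "sat M h \<phi> \<longleftrightarrow> (\<exists>(N, k) \<in> K. sat M h (\<chi> (type_of (N, k))))"
      using \<phi>(2) by (simp add: split_beta)
    also have "\<dots> \<longleftrightarrow> (\<exists>(N, k) \<in> K. \<not> separable \<tau> \<Q> d N k M h)"
      using type[OF K h] by (intro bex_cong refl) auto
    finally show "sat M h \<phi> \<longleftrightarrow> (\<exists>(N, k) \<in> K. \<not> separable \<tau> \<Q> d N k M h)" .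
  qed
qed

section \<open>The first round\<close>

lemma end_round_eq_initial_state:
  "partial_iso \<tau> p \<Longrightarrow> end_round \<tau> r Player_I d p = initial_state \<tau> r d p"
  unfolding end_round_def initial_state_def by (cases d) auto

theorem lemma3p3:
  fixes \<tau> :: "'r vocabulary" and \<Q> :: "'a quantifier set" and d :: nat
    and r :: bounded_rules
    and A B :: "('a, 'r) model" and f g :: "'a assignment"
  assumes "finite (dom \<tau>)"
    and "finite \<Q>" and "\<And>Q. Q \<in> \<Q> \<Longrightarrow> is_quantifier Q"
    and IH: "\<And>(A' :: ('a, 'r) model) (B' :: ('a, 'r) model) f' g'.
        is_model \<tau> A' \<Longrightarrow> is_model \<tau> B' \<Longrightarrow>
        is_assignment A' f' \<Longrightarrow> is_assignment B' g' \<Longrightarrow> dom f' = dom g' \<Longrightarrow>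
        Player_I_wins_EF \<tau> \<Q> r d A' B' f' g' \<longleftrightarrow> separable \<tau> \<Q> d A' f' B' g'"
    and "is_model \<tau> A" and "is_model \<tau> B"
    and "is_assignment A f" and "is_assignment B g" and "dom f = dom g"
    and "Player_I_wins_EF \<tau> \<Q> r (Suc d) A B f g"
  shows "separable \<tau> \<Q> (Suc d) A f B g"
proof (cases "initial_check r \<and> \<not> partial_iso \<tau> (A, B, f, g)")
  case True
  then show ?thesis using not_partial_iso_separable \<open>dom f = dom g\<close> by blast
next
  case False
  let ?wins = "wins \<tau> \<Q> r Player_I" and ?sep = "separable \<tau> \<Q> d"
  let ?pos = "\<lambda>M N h k. is_model \<tau> M \<and> is_model \<tau> N \<and> is_assignment M h \<and> is_assignment N k \<and>
    dom h = dom k"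

  \<comment> \<open>The induction hypothesis at the end of the round, for either role of Player I. A position
    that is no partial isomorphism is won by the attacker, and an atomic formula separates it.\<close>
  have attacking: "?sep M h N k"
    if "?wins (end_round \<tau> r Player_I d (M, N, h, k))" "?pos M N h k" for M N h k
  proof (cases "partial_iso \<tau> (M, N, h, k)")
    case True
    then have "Player_I_wins_EF \<tau> \<Q> r d M N h k"
      using that(1) end_round_eq_initial_state unfolding Player_I_wins_EF_def wins_def by metis
    then show ?thesis using IH that(2) by blast
  qed (use that(2) not_partial_iso_separable in blast)

  have defending: "\<not> ?sep M h N k"
    if "?wins (end_round \<tau> r Player_II d (M, N, h, k))" "?pos M N h k" for M N h k
  proof
    assume "?sep M h N k"
    then have I: "?wins (initial_state \<tau> r d (M, N, h, k))"
      using IH that(2) unfolding Player_I_wins_EF_def wins_def by blast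
    have "partial_iso \<tau> (M, N, h, k)"
      using that(1) wins_Over[of \<tau> \<Q> r Player_I Player_II] unfolding end_round_def
      by (auto split: if_splits)
    then have "?wins (end_round \<tau> r Player_I d (M, N, h, k))"
      using I end_round_eq_initial_state by metis
    then show False
      using not_both_roles[OF opposed_end_round] that(1) by (metis opponent.simps(1))
  qed

  have "?wins (Round_Start Player_I d (A, B, f, g))"
    using assms(10) False unfolding Player_I_wins_EF_def wins_def initial_state_def
    by (simp only: nat.case if_False)
  then obtain s where "move \<tau> \<Q> r (Round_Start Player_I d (A, B, f, g)) s" "?wins s"
    using wins_own_move[of \<tau> \<Q> r Player_I "Round_Start Player_I d (A, B, f, g)"] by auto
  then obtain Q x where Q: "Q \<in> \<Q>"
    and "?wins (Quantifier_Chosen Player_I d (A, B, f, g) Q x)"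
    by (auto elim: move.cases)
  then obtain s where s: "move \<tau> \<Q> r (Quantifier_Chosen Player_I d (A, B, f, g) Q x) s" "?wins s"
    using wins_own_move[of \<tau> \<Q> r Player_I "Quantifier_Chosen Player_I d (A, B, f, g) Q x"] by auto
  obtain M N h k X where MN: "(M, N, h, k) = (A, B, f, g) \<or> (M, N, h, k) = (B, A, g, f)"
    and X: "X \<subseteq> carrier M" "(carrier M, X) \<in> Q"
    and wX: "?wins (Witness_Chosen Player_I d (M, N, h, k) Q x X)"
    using s by cases auto

  have MN_ok: "is_model \<tau> M" "is_model \<tau> N" "is_assignment M h" "is_assignment N k" "dom h = dom k"
    using MN assms(5-9) by auto
  let ?V = "insert x (dom h)"
  have upd: "is_assignment M (h(x \<mapsto> a))" if "a \<in> carrier M" for a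
    using MN_ok(3) that unfolding is_assignment_def by (auto simp: ran_def)
  have upd': "is_assignment N (k(x \<mapsto> b))" "is_assignment N [x \<mapsto> b]" if "b \<in> carrier N" for b
    using MN_ok(4) that unfolding is_assignment_def by (auto simp: ran_def)

  have X_types: "?sep M (h(x \<mapsto> u)) M (h(x \<mapsto> u'))" if "u \<in> X" "u' \<in> carrier M - X" for u u'
  proof (rule attacking)
    show "?wins (end_round \<tau> r Player_I d (M, M, h(x \<mapsto> u), h(x \<mapsto> u')))"
      by (rule wins_opponent_move[OF wX _ move.contest_witness[OF that]]) simp
  qed (use that X(1) upd MN_ok in auto)

  have "?wins (Witness_Accepted Player_I d (M, N, h, k) Q x X)"
    by (rule wins_opponent_move[OF wX _ move.accept_witness]) simp
  then obtain s where s: "move \<tau> \<Q> r (Witness_Accepted Player_I d (M, N, h, k) Q x X) s" "?wins s"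
    using wins_own_move[of \<tau> \<Q> r Player_I "Witness_Accepted Player_I d (M, N, h, k) Q x X"] by auto
  obtain P where P: "P \<subseteq> carrier N"
    and wP: "?wins (Spillover_Chosen Player_I d (M, N, h, k) Q x X P)"
    using s by cases auto

  have P_types: "?sep M (h(x \<mapsto> v)) N (k(x \<mapsto> v'))" if "v' \<in> P" "v \<in> carrier M" for v v'
  proof (rule attacking)
    show "?wins (end_round \<tau> r Player_I d (M, N, h(x \<mapsto> v), k(x \<mapsto> v')))"
      by (rule wins_opponent_move[OF wP _ move.contest_spillover[OF that]]) simp
  qed (use that P upd upd' MN_ok in auto)

  define K where "K = (\<lambda>u. (M, h(x \<mapsto> u))) ` X \<union> (\<lambda>v. (N, k(x \<mapsto> v))) ` P"
  have "finite ?V" using MN_ok(3) unfolding is_assignment_def by simp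
  moreover have "dom k' = ?V" if "(N', k') \<in> K" for N' k'
    using that MN_ok(5) unfolding K_def by (elim UnE imageE) simp_all
  \<comment> \<open>The formula saying that \<open>x\<close> has the type of an element of \<open>X\<close> or of \<open>P\<close>.\<close>
  ultimately obtain \<phi> where \<phi>: "\<phi> \<in> FO_on \<tau> \<Q> d ?V"
    and \<phi>_iff: "\<And>M' h'. dom h' = ?V \<Longrightarrow>
      sat M' h' \<phi> \<longleftrightarrow> (\<exists>(N', k') \<in> K. \<not> ?sep N' k' M' h')"
    using union_of_types_definable[OF assms(1,2), of ?V x K d] by blast
  have sat_\<phi>: "sat M' h' \<phi> \<longleftrightarrow> (\<exists>u \<in> X. \<not> ?sep M (h(x \<mapsto> u)) M' h') \<or>
      (\<exists>v \<in> P. \<not> ?sep N (k(x \<mapsto> v)) M' h')" if "dom h' = ?V" for M' h'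
    unfolding \<phi>_iff[OF that] K_def by blast
  have not_sep_refl: "\<not> ?sep M' h' M' h'" for M' h'
    unfolding separable_def by blast

  have X_def: "{a \<in> carrier M. sat M (h(x \<mapsto> a)) \<phi>} = X"
  proof (intro equalityI subsetI)
    fix a assume a: "a \<in> X"
    then have "sat M (h(x \<mapsto> a)) \<phi>"
      by (intro sat_\<phi>[THEN iffD2] disjI1 bexI[of _ a] not_sep_refl) simp_all
    then show "a \<in> {a \<in> carrier M. sat M (h(x \<mapsto> a)) \<phi>}" using a X(1) by blast
  next
    fix a assume "a \<in> {a \<in> carrier M. sat M (h(x \<mapsto> a)) \<phi>}"
    then have a: "a \<in> carrier M" "sat M (h(x \<mapsto> a)) \<phi>" by simp_all
    have "?sep N (k(x \<mapsto> v)) M (h(x \<mapsto> a))" if "v \<in> P" for v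
      by (rule separable_sym[OF _ P_types[OF that a(1)]]) (simp add: MN_ok(5))
    then obtain u where "u \<in> X" "\<not> ?sep M (h(x \<mapsto> u)) M (h(x \<mapsto> a))"
      using a(2) sat_\<phi>[of "h(x \<mapsto> a)" M] by auto
    then show "a \<in> X" using a(1) X_types by blast
  qed

  \<comment> \<open>The answer with which the defender would refute the attacker's choices.\<close>
  define X' where "X' = {b \<in> carrier N. sat N (k(x \<mapsto> b)) \<phi>}"
  have X'_iff: "b \<in> X' \<longleftrightarrow> (\<exists>u \<in> X. \<not> ?sep M (h(x \<mapsto> u)) N (k(x \<mapsto> b))) \<or>
      (\<exists>v \<in> P. \<not> ?sep N (k(x \<mapsto> v)) N (k(x \<mapsto> b)))" if "b \<in> carrier N" for b
  proof -
    have "dom (k(x \<mapsto> b)) = ?V" using MN_ok(5) by simp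
    from sat_\<phi>[OF this] show ?thesis using that unfolding X'_def by simp
  qed
  have sep_by_\<phi>: "?sep M' h' N' k'"
    if "sat M' h' \<phi>" "\<not> sat N' k' \<phi>" "dom h' = ?V" "dom k' = ?V" for M' h' N' k'
    using \<phi> that separable_iff by blast

  have "(carrier N, X') \<notin> Q"
  proof
    assume "(carrier N, X') \<in> Q"
    moreover have "X' \<subseteq> carrier N" unfolding X'_def by blast
    moreover have "P \<subseteq> X'"
    proof
      fix v assume v: "v \<in> P"
      then show "v \<in> X'"
        using P by (intro X'_iff[THEN iffD2] disjI2 bexI[of _ v] not_sep_refl) auto
    qed
    ultimately have "?wins (Answer_Chosen Player_I d (M, N, h, k) x X P X')"
      by (intro wins_opponent_move[OF wP _ move.choose_answer]) simp_all
    then obtain s where s: "move \<tau> \<Q> r (Answer_Chosen Player_I d (M, N, h, k) x X P X') s" "?wins s"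
      using wins_own_move[of \<tau> \<Q> r Player_I "Answer_Chosen Player_I d (M, N, h, k) x X P X'"] by auto
    from s(1) show False
    proof cases
      case (contest_answer u u')
      then have w: "?wins (end_round \<tau> r Player_II d (N, N, k(x \<mapsto> u), k(x \<mapsto> u')))"
        using s(2) by simp
      have "u \<in> carrier N" using contest_answer unfolding X'_def by blast
      then have "\<not> ?sep N (k(x \<mapsto> u)) N (k(x \<mapsto> u'))"
        using contest_answer upd' MN_ok by (intro defending[OF w]) auto
      moreover have "?sep N (k(x \<mapsto> u)) N (k(x \<mapsto> u'))"
        using contest_answer MN_ok(5) unfolding X'_def by (intro sep_by_\<phi>) auto
      ultimately show False by blast
    next
      case (choose_outside v' v)
      then have w: "?wins (end_round \<tau> r Player_II d (M, N, h(x \<mapsto> v), k(x \<mapsto> v')))"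
        using s(2) by simp
      have "\<not> ?sep M (h(x \<mapsto> v)) N (k(x \<mapsto> v'))"
        using choose_outside X(1) upd upd' MN_ok by (intro defending[OF w]) auto
      moreover have "v \<in> X" "v' \<in> carrier N - X'" using choose_outside by auto
      ultimately show False using X'_iff by blast
    next
      case (choose_inside v')
      then have w: "?wins (Element_Chosen Player_I d (M, N, h, k) x X P v')" and v': "v' \<in> X'"
        using s(2) by simp_all
      have v'N: "v' \<in> carrier N" using v' unfolding X'_def by blast
      consider u where "u \<in> X" "\<not> ?sep M (h(x \<mapsto> u)) N (k(x \<mapsto> v'))"
        | v where "v \<in> P" "\<not> ?sep N (k(x \<mapsto> v)) N (k(x \<mapsto> v'))"
        using v' X'_iff[OF v'N] by blast
      then show False
      proof cases
        case 1
        have "?wins (end_round \<tau> r Player_I d (M, N, h(x \<mapsto> u), k(x \<mapsto> v')))"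
          by (rule wins_opponent_move[OF w _ move.reply_witness[OF 1(1)]]) simp
        then show False
          using attacking 1 X(1) v'N upd upd' MN_ok by (metis dom_fun_upd option.distinct(1) subsetD)
      next
        case 2
        have "?wins (end_round \<tau> r Player_I d (N, N, [x \<mapsto> v], [x \<mapsto> v']))"
          by (rule wins_opponent_move[OF w _ move.reply_spillover[OF 2(1)]]) simp
        then have "?sep N [x \<mapsto> v] N [x \<mapsto> v']"
          using 2(1) P v'N upd' MN_ok by (intro attacking) auto
        then obtain \<psi> where \<psi>: "\<psi> \<in> FO_on \<tau> \<Q> d {x}" "sat N [x \<mapsto> v] \<psi>" "\<not> sat N [x \<mapsto> v'] \<psi>"
          unfolding separable_def FO_on_def by auto
        \<comment> \<open>A formula about \<open>x\<close> alone does not notice that \<open>k\<close> has been dropped.\<close>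
        have "sat N [x \<mapsto> b] \<psi> \<longleftrightarrow> sat N (k(x \<mapsto> b)) \<psi>" for b
          using \<psi>(1) unfolding FO_on_def by (intro sat_cong) auto
        then have "?sep N (k(x \<mapsto> v)) N (k(x \<mapsto> v'))"
          using \<psi> unfolding separable_def FO_on_def by auto
        then show False using 2(2) by blast
      qed
    qed
  qed
  then have "\<not> sat N k (Quant Q x \<phi>)" unfolding X'_def by simp
  moreover have "sat M h (Quant Q x \<phi>)" using X(2) X_def by simp
  moreover have "Quant Q x \<phi> \<in> FO_on \<tau> \<Q> (Suc d) (dom h)"
    using \<phi> Q unfolding FO_on_def FO_def by auto
  ultimately have "separable \<tau> \<Q> (Suc d) M h N k"
    using separable_iff MN_ok(5) by metis
  then show ?thesis using MN separable_sym[of g f] assms(9) by auto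
qed

end
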